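(* Suppose Assumptions (A1), (A2), (A3) listed in the context hold, with tail index $\mu>0$, $\mu\notin\{1,2\}$. Then, as $N\to\infty$, the granular instrument $z_t=S'D_Nu_t$ satisfies $$z_t=\begin{cases}O_{\mathbb P}(1) & \mu\in(0,1),\\ O_{\mathbb P}\!\left(N^{-(1-1/\mu)}\right) & \mu\in(1,2),\\ O_{\mathbb P}\!\left(N^{-1/2}\right) & \mu>2.\end{cases}$$
   Context: Setting. There are $N$ units. For each date $t$, $d_t=\phi_d p_t+\varepsilon_t$ and $y_{it}=\phi_s p_t+\lambda_i'F_t+u_{it}$ ($1\le i\le N$), with $\phi_d\ne\phi_s$ real, $F_t=(F_{1t},\dots,F_{rt})'$ common factors ($r$ fixed), $\lambda_i\in\mathbb R^r$ loadings. Put $y_t=(y_{1t},\dots,y_{Nt})'$, $u_t=(u_{1t},\dots,u_{Nt})'$, $\Lambda$ the $N\times r$ matrix with rows $\lambda_i'$, $e_N=(1,\dots,1)'\in\mathbb R^N$, $D_N=I_N-e_Ne_N'/N$, $\Omega=E[u_tu_t']$. Unit sizes $\mathcal S_i>0$ give shares $S_i=\mathcal S_i/\sum_{j=1}^N\mathcal S_j$, $S=(S_1,\dots,S_N)'$. Market clearing: $d_t=S'y_t$. (A1) $(p_t,y_t',u_t',\varepsilon_t)'$ is weakly stationary with finite second moments; $E[u_t]=0$, $E[F_tu_t']=0$, $E[\varepsilon_tu_t]=0$. $\Lambda=[e_N\ \tilde\Lambda]$, where the rows $\tilde\lambda_i'$ of $\tilde\Lambda$ have mean zero. (A2) $\mathbb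 P(\mathcal S_i>s)=s^{-\mu}$ for $s\ge1$; the pairs $(\mathcal S_i,\tilde\lambda_i)$ are i.i.d. across $i$, $\mathcal S_i$ is independent of $\tilde\lambda_i$, and the array $\{(\mathcal S_i,\tilde\lambda_i)\}_i$ is independent of the process $\{(u_t,F_t,\varepsilon_t)\}_t$; $E\|\tilde\lambda_i\|^4<\infty$. (A3) There are constants $0<\underline\lambda\le K<\infty$, independent of $N$, such that all eigenvalues of $\Omega$ lie in $[\underline\lambda,K]$. *)

theory Defs
  imports "HOL-Probability.Probability" "Jordan_Normal_Form.Char_Poly"
begin

definition bigO_in_prob :: "'a measure \<Rightarrow> (nat \<Rightarrow> 'a \<Rightarrow> real) \<Rightarrow> (nat \<Rightarrow> real) \<Rightarrow> bool" where
  "bigO_in_prob M X a \<longleftrightarrow>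
     (\<forall>\<delta>>0. \<exists>B>0. \<forall>\<^sub>F n in sequentially.
        measure M {\<omega> \<in> space M. \<bar>X n \<omega>\<bar> > B * \<bar>a n\<bar>} < \<delta>)"

definition covariance :: "'a measure \<Rightarrow> ('a \<Rightarrow> real) \<Rightarrow> ('a \<Rightarrow> real) \<Rightarrow> real" where
  "covariance M X Y =
     (\<integral>\<omega>. (X \<omega> - (\<integral>\<omega>. X \<omega> \<partial>M)) * (Y \<omega> - (\<integral>\<omega>. Y \<omega> \<partial>M)) \<partial>M)"

(* A vector process is passed as the set of its scalar component processes: joint weak
   stationarity depends neither on the order of the components nor on repetitions. *)
definition weakly_stationary ::
    "'a measure \<Rightarrow> int set \<Rightarrow> (int \<Rightarrow> 'a \<Rightarrow> real) set \<Rightarrow> bool" where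
  "weakly_stationary M T \<X> \<longleftrightarrow>
     (\<forall>X\<in>\<X>. \<forall>t\<in>T. X t \<in> borel_measurable M \<and> integrable M (\<lambda>\<omega>. (X t \<omega>)\<^sup>2)) \<and>
     (\<forall>X\<in>\<X>. \<forall>s\<in>T. \<forall>t\<in>T. (\<integral>\<omega>. X s \<omega> \<partial>M) = (\<integral>\<omega>. X t \<omega> \<partial>M)) \<and>
     (\<forall>X\<in>\<X>. \<forall>Y\<in>\<X>. \<forall>s\<in>T. \<forall>t\<in>T. \<forall>h. s + h \<in> T \<and> t + h \<in> T \<longrightarrow>
        covariance M (X s) (Y (s + h)) = covariance M (X t) (Y (t + h)))"

(* indep_var forces both random variables to have the same type; this is its unfolding for
   random variables of different types. *)
definition indep_rvs ::
    "'a measure \<Rightarrow> 'b measure \<Rightarrow> ('a \<Rightarrow> 'b) \<Rightarrow> 'c measure \<Rightarrow> ('a \<Rightarrow> 'c) \<Rightarrow> bool" where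
  "indep_rvs M A X B Y \<longleftrightarrow>
     X \<in> measurable M A \<and> Y \<in> measurable M B \<and>
     prob_space.indep_set M
       (sets (vimage_algebra (space M) X A)) (sets (vimage_algebra (space M) Y B))"

definition second_moment_mat :: "'a measure \<Rightarrow> nat \<Rightarrow> (nat \<Rightarrow> 'a \<Rightarrow> real) \<Rightarrow> real mat" where
  "second_moment_mat M N v = mat N N (\<lambda>(i, j). \<integral>\<omega>. v i \<omega> * v j \<omega> \<partial>M)"

definition share :: "nat \<Rightarrow> (nat \<Rightarrow> 'a \<Rightarrow> real) \<Rightarrow> nat \<Rightarrow> 'a \<Rightarrow> real" where
  "share N sz i \<omega> = sz i \<omega> / (\<Sum>j<N. sz j \<omega>)"

(* D = I - e e' / N, where e e' is the all-ones matrix. *)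
definition demeaning_mat :: "nat \<Rightarrow> real mat" where
  "demeaning_mat N = 1\<^sub>m N - (1 / real N) \<cdot>\<^sub>m mat N N (\<lambda>_. 1)"

definition granular_instrument ::
    "nat \<Rightarrow> (nat \<Rightarrow> 'a \<Rightarrow> real) \<Rightarrow> (nat \<Rightarrow> 'a \<Rightarrow> real) \<Rightarrow> 'a \<Rightarrow> real" where
  "granular_instrument N sz v \<omega> =
     vec N (\<lambda>i. share N sz i \<omega>) \<bullet> (demeaning_mat N *\<^sub>v vec N (\<lambda>i. v i \<omega>))"

(* Market with N units i < N, dates T and r factors j < r.  The full loading vector of unit i is
   (lam i 0, ..., lam i (r - 1)). *)
locale granular_market = prob_space M
  for M :: "'a measure" +
  fixes N r :: nat
    and \<phi>\<^sub>d \<phi>\<^sub>s :: real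
    and T :: "int set"
    and sz :: "nat \<Rightarrow> 'a \<Rightarrow> real"
    and lam :: "nat \<Rightarrow> nat \<Rightarrow> 'a \<Rightarrow> real"
    and F u :: "nat \<Rightarrow> int \<Rightarrow> 'a \<Rightarrow> real"
    and \<epsilon> p d :: "int \<Rightarrow> 'a \<Rightarrow> real"
    and y :: "nat \<Rightarrow> int \<Rightarrow> 'a \<Rightarrow> real"
  assumes N_pos: "N \<ge> 1"
    and r_pos: "r \<ge> 1"
    and slopes: "\<phi>\<^sub>d \<noteq> \<phi>\<^sub>s"
    and sz_measurable: "\<And>i. i < N \<Longrightarrow> sz i \<in> borel_measurable M"
    and sz_pos: "\<And>i. i < N \<Longrightarrow> AE \<omega> in M. sz i \<omega> > 0"
    and lam_measurable: "\<And>i j. i < N \<Longrightarrow> j < r \<Longrightarrow> lam i j \<in> borel_measurable M"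
    and F_measurable: "\<And>j t. j < r \<Longrightarrow> t \<in> T \<Longrightarrow> F j t \<in> borel_measurable M"
    and u_measurable: "\<And>i t. i < N \<Longrightarrow> t \<in> T \<Longrightarrow> u i t \<in> borel_measurable M"
    and \<epsilon>_measurable: "\<And>t. t \<in> T \<Longrightarrow> \<epsilon> t \<in> borel_measurable M"
    and demand_eq: "\<And>t. t \<in> T \<Longrightarrow> AE \<omega> in M. d t \<omega> = \<phi>\<^sub>d * p t \<omega> + \<epsilon> t \<omega>"
    and supply_eq: "\<And>i t. i < N \<Longrightarrow> t \<in> T \<Longrightarrow>
      AE \<omega> in M. y i t \<omega> = \<phi>\<^sub>s * p t \<omega> + (\<Sum>j<r. lam i j \<omega> * F j t \<omega>) + u i t \<omega>"
    and market_clearing: "\<And>t. t \<in> T \<Longrightarrow>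
      AE \<omega> in M. d t \<omega> = (\<Sum>i<N. share N sz i \<omega> * y i t \<omega>)"

locale stationary_granular_market = granular_market +
  assumes stationary: "weakly_stationary M T ({p, \<epsilon>} \<union> y ` {..<N} \<union> u ` {..<N})"
    and u_mean: "\<And>i t. i < N \<Longrightarrow> t \<in> T \<Longrightarrow> expectation (u i t) = 0"
    and F_u_integrable: "\<And>i j t. i < N \<Longrightarrow> j < r \<Longrightarrow> t \<in> T \<Longrightarrow>
      integrable M (\<lambda>\<omega>. F j t \<omega> * u i t \<omega>)"
    and F_u_uncorrelated: "\<And>i j t. i < N \<Longrightarrow> j < r \<Longrightarrow> t \<in> T \<Longrightarrow>
      expectation (\<lambda>\<omega>. F j t \<omega> * u i t \<omega>) = 0"
    and \<epsilon>_u_uncorrelated: "\<And>i t. i < N \<Longrightarrow> t \<in> T \<Longrightarrow>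
      expectation (\<lambda>\<omega>. \<epsilon> t \<omega> * u i t \<omega>) = 0"
    and lam_first: "\<And>i. i < N \<Longrightarrow> AE \<omega> in M. lam i 0 \<omega> = 1"
    and lam_integrable: "\<And>i j. i < N \<Longrightarrow> j \<in> {1..<r} \<Longrightarrow> integrable M (lam i j)"
    and lam_mean: "\<And>i j. i < N \<Longrightarrow> j \<in> {1..<r} \<Longrightarrow> expectation (lam i j) = 0"

(* The non-constant part of the loading vector, with components 1, ..., r - 1. *)
definition lam_tilde :: "nat \<Rightarrow> (nat \<Rightarrow> nat \<Rightarrow> 'a \<Rightarrow> real) \<Rightarrow> nat \<Rightarrow> 'a \<Rightarrow> nat \<Rightarrow> real" where
  "lam_tilde r lam i \<omega> = (\<lambda>j\<in>{1..<r}. lam i j \<omega>)"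

abbreviation lam_tilde_space :: "nat \<Rightarrow> (nat \<Rightarrow> real) measure" where
  "lam_tilde_space r \<equiv> \<Pi>\<^sub>M j\<in>{1..<r}. borel"

abbreviation unit_space :: "nat \<Rightarrow> (real \<times> (nat \<Rightarrow> real)) measure" where
  "unit_space r \<equiv> borel \<Otimes>\<^sub>M lam_tilde_space r"

abbreviation shock_space ::
    "nat \<Rightarrow> nat \<Rightarrow> ((nat \<Rightarrow> real) \<times> (nat \<Rightarrow> real) \<times> real) measure" where
  "shock_space N r \<equiv> (\<Pi>\<^sub>M i\<in>{..<N}. borel) \<Otimes>\<^sub>M (\<Pi>\<^sub>M j\<in>{..<r}. borel) \<Otimes>\<^sub>M borel"

locale pareto_granular_market = stationary_granular_market +
  fixes \<mu> :: real
  assumes pareto: "\<And>i s. i < N \<Longrightarrow> s \<ge> 1 \<Longrightarrow>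
      prob {\<omega> \<in> space M. sz i \<omega> > s} = s powr (- \<mu>)"
    and units_indep:
      "indep_vars (\<lambda>_. unit_space r) (\<lambda>i \<omega>. (sz i \<omega>, lam_tilde r lam i \<omega>)) {..<N}"
    and units_identically_distributed: "\<And>i k. i < N \<Longrightarrow> k < N \<Longrightarrow>
      distr M (unit_space r) (\<lambda>\<omega>. (sz i \<omega>, lam_tilde r lam i \<omega>)) =
      distr M (unit_space r) (\<lambda>\<omega>. (sz k \<omega>, lam_tilde r lam k \<omega>))"
    and size_lam_indep: "\<And>i. i < N \<Longrightarrow>
      indep_rvs M borel (sz i) (lam_tilde_space r) (lam_tilde r lam i)"
    and units_shocks_indep:
      "indep_rvs M
        (\<Pi>\<^sub>M i\<in>{..<N}. unit_space r)
        (\<lambda>\<omega>. \<lambda>i\<in>{..<N}. (sz i \<omega>, lam_tilde r lam i \<omega>))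
        (\<Pi>\<^sub>M t\<in>T. shock_space N r)
        (\<lambda>\<omega>. \<lambda>t\<in>T. (\<lambda>i\<in>{..<N}. u i t \<omega>, \<lambda>j\<in>{..<r}. F j t \<omega>, \<epsilon> t \<omega>))"
    and lam_fourth_moment: "\<And>i. i < N \<Longrightarrow>
      integrable M (\<lambda>\<omega>. L2_set (lam_tilde r lam i \<omega>) {1..<r} ^ 4)"

(* The second-moment matrix is real symmetric, so its eigenvalues are all real. *)
locale regular_granular_market = pareto_granular_market +
  fixes \<kappa> K :: real
  assumes eigenvalue_bounds: "\<And>t k. t \<in> T \<Longrightarrow>
      eigenvalue (second_moment_mat M N (\<lambda>i. u i t)) k \<Longrightarrow> k \<in> {\<kappa>..K}"

end

theory Submission
  imports Defs
begin

text \<open>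
  Write \<open>z = \<Sum> w\<^sub>i u\<^sub>i\<close>, where \<open>w\<^sub>i\<close> is the demeaned share of unit \<open>i\<close>. The weights are independent
  of the shocks, so on any event that depends on the sizes only, the second moment of \<open>z\<close> is at most
  \<open>K\<close> times that of the Herfindahl index \<open>\<Sum> S\<^sub>i\<^sup>2\<close>. This index is at most 1, which settles
  \<open>\<mu> < 1\<close>. Otherwise, since Pareto sizes exceed 1 almost surely, their sum is at least \<open>N\<close> and no
  law of large numbers is needed: truncating the sizes at \<open>L = b N powr (1 / \<mu>)\<close>
  discards an event of probability at most \<open>b powr (- \<mu>)\<close>, and on the rest the index is dominated by
  the sum of the truncated squared sizes divided by \<open>N\<^sup>2\<close>.
\<close>

section \<open>Quadratic forms and eigenvalues of a symmetric matrix\<close>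

text \<open>Rayleigh quotient argument: the form attains a maximum on the unit sphere, every
  maximiser is an eigenvector, and the maximum is its eigenvalue. Homogeneity then carries the bound
  to all \<open>w\<close>.\<close>

lemma quadratic_form_le_max_eigenvalue:
  fixes A :: "nat \<Rightarrow> nat \<Rightarrow> real" and w :: "nat \<Rightarrow> real"
  assumes sym: "\<And>i j. i < n \<Longrightarrow> j < n \<Longrightarrow> A i j = A j i"
    and ev: "\<And>k. eigenvalue (mat n n (\<lambda>(i, j). A i j)) k \<Longrightarrow> k \<le> K"
  shows "(\<Sum>i<n. \<Sum>j<n. w i * w j * A i j) \<le> K * (\<Sum>i<n. (w i)\<^sup>2)"
proof -
  define Q where "Q = (\<lambda>x. \<Sum>i<n. \<Sum>j<n. x i * x j * A i j)"
  define q where "q = (\<lambda>x :: nat \<Rightarrow> real. \<Sum>i<n. (x i)\<^sup>2)"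
  have q_nonneg: "q x \<ge> 0" for x
    by (simp add: q_def sum_nonneg)
  have Q_zero: "Q x = 0" if "q x = 0" for x
  proof -
    have "x i = 0" if "i < n" for i
      using \<open>q x = 0\<close> that unfolding q_def by (subst (asm) sum_nonneg_eq_0_iff) auto
    then show ?thesis by (simp add: Q_def)
  qed
  show ?thesis
  \<comment> \<open>The degenerate case covers \<open>n = 0\<close>, where the sphere is empty. In
    the other case the normalised \<open>w\<close> shows that the sphere is nonempty.\<close>
  proof (cases "q w = 0")
    case True
    then show ?thesis using Q_zero[of w] by (simp add: Q_def q_def)
  next
    case False
    \<comment> \<open>Vectors are functions on all of \<open>nat\<close>, so the coordinates from
      \<open>n\<close> on are pinned to 0. The box \<open>?P\<close> is then compact as a product of
      compact sets, and \<open>?S\<close> is the unit sphere as a closed subset of it.\<close>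
    let ?P = "PiE UNIV (\<lambda>i. if i < n then {-1..1::real} else {0})"
    let ?S = "?P \<inter> {x. q x = 1}"
    define nrm where "nrm = (\<lambda>x i. if i < n then x i / sqrt (q x) else 0 :: real)"
    have nrm: "nrm x \<in> ?S" "Q x = q x * Q (nrm x)" if "q x \<noteq> 0" for x
    proof -
      have pos: "q x > 0" using that q_nonneg[of x] by simp
      have one: "q (nrm x) = 1"
        using pos by (simp add: nrm_def q_def power_divide flip: sum_divide_distrib)
      have "\<bar>nrm x i\<bar> \<le> 1" if "i < n" for i
      proof -
        have "(nrm x i)\<^sup>2 \<le> q (nrm x)"
          unfolding q_def by (rule member_le_sum) (use that in auto)
        then show ?thesis using one by (simp add: abs_square_le_1)
      qed
      then have "nrm x i \<in> (if i < n then {-1..1} else {0})" for i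
        by (simp add: nrm_def abs_le_iff minus_le_iff del: abs_divide)
      then show "nrm x \<in> ?S"
        using one by (simp add: PiE_UNIV_domain Pi_iff)
      have "q x * Q (nrm x) = (\<Sum>i<n. \<Sum>j<n. q x * (nrm x i * nrm x j * A i j))"
        by (simp add: Q_def sum_distrib_left)
      also have "\<dots> = Q x"
        unfolding Q_def using pos
        by (intro sum.cong refl) (simp add: nrm_def)
      finally show "Q x = q x * Q (nrm x)" by simp
    qed
    have "compact ?P"
      unfolding compactin_euclidean_iff[symmetric] euclidean_product_topology[symmetric] compactin_PiE
      by (simp add: compactin_PiE)
    moreover have "closed {x. q x = 1}"
      unfolding q_def by (intro closed_Collect_eq continuous_intros continuous_on_product_coordinates)
    ultimately have "compact ?S" by (rule compact_Int_closed)
    moreover have "continuous_on UNIV Q"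
      unfolding Q_def by (intro continuous_intros continuous_on_product_coordinates)
    then have "continuous_on ?S Q"
      by (rule continuous_on_subset) simp
    moreover have "?S \<noteq> {}" using nrm(1)[OF False] by blast
    ultimately obtain v where v: "v \<in> ?S" and max: "\<And>x. x \<in> ?S \<Longrightarrow> Q x \<le> Q v"
      using continuous_attains_sup by metis
    define m where "m = Q v"
    have bound: "Q x \<le> m * q x" for x
    proof (cases "q x = 0")
      case True
      then show ?thesis using Q_zero by simp
    next
      case False
      then show ?thesis
        using nrm[OF False] max[OF nrm(1)[OF False]] q_nonneg[of x]
        by (simp add: m_def mult.commute mult_right_mono)
    qed
    \<comment> \<open>Moving from the maximiser \<open>v\<close> along its residual \<open>g\<close> forces \<open>g = 0\<close>, so \<open>v\<close> is an eigenvector.\<close>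
    define g where "g = (\<lambda>i. (\<Sum>j<n. A i j * v j) - m * v i)"
    have qv: "q v = 1" using v by simp
    have expand: "m * q (\<lambda>i. v i + t * g i) - Q (\<lambda>i. v i + t * g i)
        = t\<^sup>2 * (m * q g - Q g) - 2 * t * q g" for t
    proof -
      have a: "(\<Sum>i<n. \<Sum>j<n. g i * v j * A i j) = q g + m * (\<Sum>i<n. v i * g i)"
      proof -
        have "(\<Sum>j<n. g i * v j * A i j) = (g i)\<^sup>2 + m * (v i * g i)" for i
        proof -
          have "(\<Sum>j<n. g i * v j * A i j) = g i * (\<Sum>j<n. A i j * v j)"
            by (simp add: sum_distrib_left mult_ac)
          also have "(\<Sum>j<n. A i j * v j) = g i + m * v i" by (simp add: g_def)
          finally show ?thesis by (simp add: algebra_simps power2_eq_square)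
        qed
        then show ?thesis by (simp add: q_def sum.distrib sum_distrib_left)
      qed
      \<comment> \<open>Symmetry of \<open>A\<close> makes the two mixed terms equal, so together
        they contribute twice the value found in \<open>a\<close>.\<close>
      have b: "(\<Sum>i<n. \<Sum>j<n. v i * g j * A i j) = (\<Sum>i<n. \<Sum>j<n. g i * v j * A i j)"
        by (subst sum.swap) (intro sum.cong refl, simp add: sym mult_ac)
      have "Q (\<lambda>i. v i + t * g i) = Q v + t * (\<Sum>i<n. \<Sum>j<n. v i * g j * A i j)
          + t * (\<Sum>i<n. \<Sum>j<n. g i * v j * A i j) + t\<^sup>2 * Q g"
        by (simp add: Q_def sum_distrib_left algebra_simps sum.distrib power2_eq_square)
      moreover have "q (\<lambda>i. v i + t * g i) = q v + 2 * t * (\<Sum>i<n. v i * g i) + t\<^sup>2 * q g"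
        by (simp add: q_def sum_distrib_left algebra_simps sum.distrib power2_eq_square)
      ultimately show ?thesis
        using a b qv by (simp add: m_def algebra_simps)
    qed
    have "q g = 0"
    proof (rule ccontr)
      assume "q g \<noteq> 0"
      then have pos: "q g > 0" using q_nonneg[of g] by simp
      define c where "c = m * q g - Q g"
      \<comment> \<open>By \<open>bound\<close> the expression in \<open>expand\<close> is
        nonnegative for every \<open>t\<close>, but for small \<open>t > 0\<close> its linear term
        \<open>- 2 * t * q g\<close> wins. This \<open>t\<close> is small enough because
        \<open>t * c\<close> is at most \<open>q g\<close>; the \<open>+ 1\<close> avoids a zero
        denominator.\<close>
      define t where "t = q g / (\<bar>c\<bar> + 1)"
      have t: "t > 0" using pos by (simp add: t_def)
      have "0 \<le> t * (t * c - 2 * q g)"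
        using expand[of t] bound[of "\<lambda>i. v i + t * g i"]
        by (simp add: c_def algebra_simps power2_eq_square)
      then have "2 * q g \<le> t * c" using t by (simp add: zero_le_mult_iff)
      also have "t * c \<le> t * (\<bar>c\<bar> + 1)" using t by (intro mult_left_mono) auto
      also have "\<dots> = q g" by (simp add: t_def)
      finally show False using pos by simp
    qed
    then have g0: "g i = 0" if "i < n" for i
      using that unfolding q_def by (subst (asm) sum_nonneg_eq_0_iff) auto
    have "eigenvector (mat n n (\<lambda>(i, j). A i j)) (vec n v) m"
      unfolding eigenvector_def
    proof (intro conjI)
      show "vec n v \<noteq> 0\<^sub>v (dim_row (mat n n (\<lambda>(i, j). A i j)))"
      proof
        assume "vec n v = 0\<^sub>v (dim_row (mat n n (\<lambda>(i, j). A i j)))"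
        then have "v i = 0" if "i < n" for i
          using that by (metis dim_row_mat(1) index_vec index_zero_vec(1))
        then have "q v = 0" by (simp add: q_def)
        then show False using qv by simp
      qed
      show "mat n n (\<lambda>(i, j). A i j) *\<^sub>v vec n v = m \<cdot>\<^sub>v vec n v"
        using g0 by (intro eq_vecI) (auto simp: g_def scalar_prod_def lessThan_atLeast0)
    qed auto
    then have "m \<le> K" using ev unfolding eigenvalue_def by blast
    then have "m * q w \<le> K * q w" by (intro mult_right_mono q_nonneg)
    with bound[of w] show ?thesis by (simp add: Q_def q_def)
  qed
qed

section \<open>Independence and integrability of functions of random variables\<close>

lemma sigma_sets_compose_subset_vimage_algebra:
  assumes Z: "Z \<in> measurable M C" and h: "h \<in> measurable C D"
  shows "sigma_sets (space M) {(\<lambda>\<omega>. h (Z \<omega>)) -` S \<inter> space M | S. S \<in> sets D}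
    \<subseteq> sets (vimage_algebra (space M) Z C)"
proof -
  have "(\<lambda>\<omega>. h (Z \<omega>)) -` S \<inter> space M \<in> sets (vimage_algebra (space M) Z C)" if "S \<in> sets D" for S
  proof -
    have "(\<lambda>\<omega>. h (Z \<omega>)) -` S \<inter> space M = Z -` (h -` S \<inter> space C) \<inter> space M"
      using measurable_space[OF Z] by auto
    then show ?thesis
      using in_vimage_algebra[OF measurable_sets[OF h that]] by metis
  qed
  then have "sigma_sets (space (vimage_algebra (space M) Z C))
      {(\<lambda>\<omega>. h (Z \<omega>)) -` S \<inter> space M | S. S \<in> sets D}
    \<subseteq> sets (vimage_algebra (space M) Z C)"
    by (intro sets.sigma_sets_subset) blast
  then show ?thesis by simp
qed

text \<open>The sigma-algebras generated by \<open>f (X \<omega>)\<close> and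
  \<open>g (Y \<omega>)\<close> lie inside those generated by \<open>X\<close> and \<open>Y\<close>,
  so independence is inherited. This leads from random variables of different types to
  \<open>indep_var\<close>, where the product rule for expectations is available.\<close>

lemma (in prob_space) indep_rvs_compose:
  assumes "indep_rvs M A X B Y" "f \<in> measurable A C" "g \<in> measurable B D"
  shows "indep_var C (\<lambda>\<omega>. f (X \<omega>)) D (\<lambda>\<omega>. g (Y \<omega>))"
proof -
  have X: "X \<in> measurable M A" and Y: "Y \<in> measurable M B"
    and ind: "indep_set (sets (vimage_algebra (space M) X A)) (sets (vimage_algebra (space M) Y B))"
    using assms(1) by (auto simp: indep_rvs_def)
  have "indep_set
      (sigma_sets (space M) {(\<lambda>\<omega>. f (X \<omega>)) -` S \<inter> space M | S. S \<in> sets C})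
      (sigma_sets (space M) {(\<lambda>\<omega>. g (Y \<omega>)) -` S \<inter> space M | S. S \<in> sets D})"
    using sigma_sets_compose_subset_vimage_algebra[OF X assms(2)]
      sigma_sets_compose_subset_vimage_algebra[OF Y assms(3)] ind
    unfolding indep_sets2_eq by blast
  then show ?thesis
    unfolding indep_var_eq
    using measurable_compose[OF X assms(2)] measurable_compose[OF Y assms(3)] by simp
qed

lemma integrable_mult_square_integrable:
  fixes f g :: "'a \<Rightarrow> real"
  assumes [measurable]: "f \<in> borel_measurable M" "g \<in> borel_measurable M"
    and "integrable M (\<lambda>x. (f x)\<^sup>2)" "integrable M (\<lambda>x. (g x)\<^sup>2)"
  shows "integrable M (\<lambda>x. f x * g x)"
proof (rule Bochner_Integration.integrable_bound)
  show "integrable M (\<lambda>x. (f x)\<^sup>2 + (g x)\<^sup>2)" using assms by simp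
  have "\<bar>a * b\<bar> \<le> a\<^sup>2 + b\<^sup>2" for a b :: real
    using sum_squares_bound[of "\<bar>a\<bar>" "\<bar>b\<bar>"] abs_ge_zero[of "a * b"]
    unfolding abs_mult power2_abs by linarith
  then show "AE x in M. norm (f x * g x) \<le> norm ((f x)\<^sup>2 + (g x)\<^sup>2)" by simp
qed simp

section \<open>Demeaning and the weighted-sum form of the instrument\<close>

text \<open>Demeaning is an orthogonal projection: it lowers the sum of squares by \<open>n\<close>
  times the squared mean.\<close>

lemma sum_square_diff_mean_le:
  fixes x :: "nat \<Rightarrow> real"
  shows "(\<Sum>i<n. (x i - (\<Sum>j<n. x j) / n)\<^sup>2) \<le> (\<Sum>i<n. (x i)\<^sup>2)"
proof (cases "n = 0")
  case False
  define m where "m = (\<Sum>j<n. x j) / n"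
  have "(\<Sum>i<n. (x i - m)\<^sup>2) = (\<Sum>i<n. (x i)\<^sup>2) - 2 * m * (\<Sum>i<n. x i) + n * m\<^sup>2"
    by (simp add: power2_diff sum.distrib sum_subtractf sum_distrib_left mult_ac)
  also have "(\<Sum>i<n. x i) = n * m" using False by (simp add: m_def)
  also have "(\<Sum>i<n. (x i)\<^sup>2) - 2 * m * (n * m) + n * m\<^sup>2 = (\<Sum>i<n. (x i)\<^sup>2) - n * m\<^sup>2"
    by (simp add: power2_eq_square)
  finally show ?thesis by (simp add: m_def)
qed simp

text \<open>The demeaning matrix is symmetric, so it can be moved from the shocks to the shares.
  Each shock then stands next to a weight that depends on the sizes only.\<close>

lemma granular_instrument_altdef:
  "granular_instrument N s v \<omega> =
     (\<Sum>i<N. (share N s i \<omega> - (\<Sum>j<N. share N s j \<omega>) / N) * v i \<omega>)"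
proof -
  let ?S = "\<lambda>i. share N s i \<omega>"
  have [simp]: "dim_row (demeaning_mat N) = N" by (simp add: demeaning_mat_def)
  have D: "vec_index (demeaning_mat N *\<^sub>v vec N (\<lambda>i. v i \<omega>)) i = v i \<omega> - (\<Sum>j<N. v j \<omega>) / N"
    if "i < N" for i
  proof -
    have "vec_index (demeaning_mat N *\<^sub>v vec N (\<lambda>i. v i \<omega>)) i
        = (\<Sum>j<N. ((if i = j then 1 else 0) - 1 / N) * v j \<omega>)"
      using that by (auto simp: demeaning_mat_def scalar_prod_def Matrix.row_def lessThan_atLeast0 intro!: sum.cong)
    also have "\<dots> = (\<Sum>j<N. (if i = j then v j \<omega> else 0)) - (\<Sum>j<N. v j \<omega>) / N"
      unfolding sum_divide_distrib sum_subtractf[symmetric]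
      by (intro sum.cong) (auto simp: algebra_simps)
    finally show ?thesis using that by simp
  qed
  have "granular_instrument N s v \<omega> = (\<Sum>i<N. ?S i * (v i \<omega> - (\<Sum>j<N. v j \<omega>) / N))"
    unfolding granular_instrument_def scalar_prod_def
    by (intro sum.cong) (auto simp: D simp del: index_mult_mat_vec)
  also have "\<dots> = (\<Sum>i<N. ?S i * v i \<omega>) - (\<Sum>i<N. ?S i) / N * (\<Sum>j<N. v j \<omega>)"
    by (simp add: right_diff_distrib sum_subtractf flip: sum_distrib_right sum_divide_distrib)
  also have "\<dots> = (\<Sum>i<N. (?S i - (\<Sum>j<N. ?S j) / N) * v i \<omega>)"
    by (simp add: left_diff_distrib sum_subtractf flip: sum_distrib_left sum_divide_distrib)
  finally show ?thesis .
qed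

section \<open>Second moment of the instrument on an event determined by the sizes\<close>

context regular_granular_market
begin

lemma share_bounds: "AE \<omega> in M. \<forall>i<N. 0 \<le> share N sz i \<omega> \<and> share N sz i \<omega> \<le> 1"
proof -
  have "AE \<omega> in M. \<forall>i\<in>{..<N}. sz i \<omega> > 0"
    by (rule AE_finite_allI) (use sz_pos in auto)
  then show ?thesis
  proof eventually_elim
    case (elim \<omega>)
    have "sz i \<omega> \<le> (\<Sum>j<N. sz j \<omega>)" if "i < N" for i
      using elim that by (intro member_le_sum) (auto intro: less_imp_le)
    moreover have "(\<Sum>j<N. sz j \<omega>) > 0"
      using elim N_pos by (intro sum_pos) (auto simp: lessThan_empty_iff)
    ultimately show ?case using elim by (auto simp: share_def intro!: less_imp_le)
  qed
qed

text \<open>The indicator \<open>G\<close> and the weights are functions of the sizes, so each term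
  of the expanded square factors into a size expectation and an entry of the second-moment matrix of
  the shocks. The eigenvalue bound and the contraction under demeaning then apply pointwise to the
  weights.\<close>

lemma second_moment_le:
  assumes t: "t \<in> T" and K_nonneg: "0 \<le> K"
    and [measurable]: "C \<in> sets (\<Pi>\<^sub>M i\<in>{..<N}. borel)"
  defines "G \<equiv> \<lambda>\<omega>. indicator C (\<lambda>i\<in>{..<N}. sz i \<omega>) :: real"
    and "z \<equiv> granular_instrument N sz (\<lambda>i. u i t)"
  shows "integrable M (\<lambda>\<omega>. G \<omega> * (z \<omega>)\<^sup>2)"
    and "expectation (\<lambda>\<omega>. G \<omega> * (z \<omega>)\<^sup>2)
      \<le> K * expectation (\<lambda>\<omega>. G \<omega> * (\<Sum>i<N. (share N sz i \<omega>)\<^sup>2))"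
proof -
  define X where "X = (\<lambda>\<omega>. \<lambda>i\<in>{..<N}. (sz i \<omega>, lam_tilde r lam i \<omega>))"
  define Y where "Y = (\<lambda>\<omega>. \<lambda>t\<in>T. (\<lambda>i\<in>{..<N}. u i t \<omega>, \<lambda>j\<in>{..<r}. F j t \<omega>, \<epsilon> t \<omega>))"
  \<comment> \<open>\<open>sh\<close> and \<open>dv\<close> express the shares and their demeaned
    versions through the array of units alone, the object to which the independence assumption
    refers.\<close>
  define sh where "sh = (\<lambda>(x :: nat \<Rightarrow> real \<times> (nat \<Rightarrow> real)) i. fst (x i) / (\<Sum>j<N. fst (x j)))"
  define dv where "dv = (\<lambda>x i. sh x i - (\<Sum>j<N. sh x j) / N)"
  define w where "w i \<omega> = share N sz i \<omega> - (\<Sum>j<N. share N sz j \<omega>) / N" for i \<omega>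
  define \<Omega> where "\<Omega> = (\<lambda>i j. expectation (\<lambda>\<omega>. u i t \<omega> * u j t \<omega>))"
  note [measurable] = sz_measurable
  have G_meas [measurable]: "G \<in> borel_measurable M"
    unfolding G_def by measurable
  have share_meas [measurable]: "share N sz i \<in> borel_measurable M" if "i < N" for i
    unfolding share_def using that by measurable
  have u_meas [measurable]: "u i t \<in> borel_measurable M" if "i < N" for i
    using u_measurable t that by blast
  have w_meas [measurable]: "w i \<in> borel_measurable M" if "i < N" for i
    unfolding w_def[abs_def] using that by measurable
  have u_sq: "integrable M (\<lambda>\<omega>. (u i t \<omega>)\<^sup>2)" if "i < N" for i
    using stationary t that unfolding weakly_stationary_def by auto
  have uu: "integrable M (\<lambda>\<omega>. u i t \<omega> * u j t \<omega>)" if "i < N" "j < N" for i j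
    using that by (intro integrable_mult_square_integrable u_sq) auto
  have G_bound: "\<bar>G \<omega>\<bar> \<le> 1" for \<omega> by (simp add: G_def indicator_def)
  \<comment> \<open>A share and the mean share both lie between 0 and 1, so their difference has
    modulus at most 1.\<close>
  have w_bound: "AE \<omega> in M. \<forall>i<N. \<bar>w i \<omega>\<bar> \<le> 1"
    using share_bounds
  proof eventually_elim
    case (elim \<omega>)
    have "(\<Sum>j<N. share N sz j \<omega>) \<le> (\<Sum>j<N. 1)" using elim by (intro sum_mono) auto
    then have "(\<Sum>j<N. share N sz j \<omega>) / N \<le> 1" using N_pos by simp
    moreover have "(\<Sum>j<N. share N sz j \<omega>) / N \<ge> 0" using elim by (auto intro!: sum_nonneg divide_nonneg_nonneg)
    ultimately show ?case using elim unfolding w_def by (smt (verit))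
  qed
  have Gww: "integrable M (\<lambda>\<omega>. G \<omega> * (w i \<omega> * w j \<omega>))" if "i < N" "j < N" for i j
  proof (rule integrable_const_bound[where B = 1])
    show "AE \<omega> in M. norm (G \<omega> * (w i \<omega> * w j \<omega>)) \<le> 1"
      using w_bound
      by eventually_elim (use that G_bound in \<open>auto simp: abs_mult intro!: mult_le_one\<close>)
  qed (use that in measurable)
  have Gshsh: "integrable M (\<lambda>\<omega>. G \<omega> * (share N sz i \<omega>)\<^sup>2)" if "i < N" for i
  proof (rule integrable_const_bound[where B = 1])
    show "AE \<omega> in M. norm (G \<omega> * (share N sz i \<omega>)\<^sup>2) \<le> 1"
      using share_bounds
      by eventually_elim
        (use that G_bound in \<open>auto simp: abs_mult power_le_one intro!: mult_le_one\<close>)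
  qed (use that in measurable)
  have ind: "indep_var borel (\<lambda>\<omega>. G \<omega> * (w i \<omega> * w j \<omega>)) borel (\<lambda>\<omega>. u i t \<omega> * u j t \<omega>)"
    if ij: "i < N" "j < N" for i j
  proof -
    \<comment> \<open>Independence is assumed between the whole unit array \<open>X\<close> and the
      whole shock process \<open>Y\<close>; \<open>f\<close> and \<open>g\<close> present the two
      factors as measurable functions of these.\<close>
    define f where "f = (\<lambda>x. indicator C (\<lambda>i\<in>{..<N}. fst (x i)) * (dv x i * dv x j) :: real)"
    define g where "g = (\<lambda>y :: int \<Rightarrow> (nat \<Rightarrow> real) \<times> (nat \<Rightarrow> real) \<times> real. fst (y t) i * fst (y t) j)"
    have comp: "(\<lambda>x. fst (x k)) \<in> borel_measurable (\<Pi>\<^sub>M i\<in>{..<N}. unit_space r)" if "k < N" for k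
      by (rule measurable_compose[OF measurable_component_singleton[where i = k] measurable_fst])
        (use that in simp)
    have sh: "(\<lambda>x. sh x k) \<in> borel_measurable (\<Pi>\<^sub>M i\<in>{..<N}. unit_space r)" if "k < N" for k
      unfolding sh_def using that by (intro borel_measurable_divide borel_measurable_sum comp) auto
    have dv: "(\<lambda>x. dv x k) \<in> borel_measurable (\<Pi>\<^sub>M i\<in>{..<N}. unit_space r)" if "k < N" for k
      unfolding dv_def using that
      by (intro borel_measurable_divide borel_measurable_sum borel_measurable_diff sh) auto
    have C: "(\<lambda>x. indicator C (\<lambda>i\<in>{..<N}. fst (x i)) :: real)
        \<in> borel_measurable (\<Pi>\<^sub>M i\<in>{..<N}. unit_space r)"
      by (rule measurable_compose[where N = "\<Pi>\<^sub>M i\<in>{..<N}. borel" and f = "\<lambda>x. \<lambda>i\<in>{..<N}. fst (x i)"],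
          intro measurable_restrict comp) auto
    have f: "f \<in> borel_measurable (\<Pi>\<^sub>M i\<in>{..<N}. unit_space r)"
      unfolding f_def using ij by (intro borel_measurable_times C dv)
    have g: "g \<in> borel_measurable (\<Pi>\<^sub>M t\<in>T. shock_space N r)"
    proof -
      have "(\<lambda>y. fst (y t) k) \<in> borel_measurable (\<Pi>\<^sub>M t\<in>T. shock_space N r)" if "k < N" for k
      proof -
        have "(\<lambda>y. fst (y t)) \<in> measurable (\<Pi>\<^sub>M t\<in>T. shock_space N r) (\<Pi>\<^sub>M i\<in>{..<N}. borel)"
          using t by measurable
        then show ?thesis
          by (rule measurable_compose) (use that in \<open>auto intro!: measurable_component_singleton\<close>)
      qed
      then show ?thesis unfolding g_def using ij by (intro borel_measurable_times)
    qed
    have "indep_var borel (\<lambda>\<omega>. f (X \<omega>)) borel (\<lambda>\<omega>. g (Y \<omega>))"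
      using units_shocks_indep unfolding X_def[symmetric] Y_def[symmetric]
      by (rule indep_rvs_compose[OF _ f g])
    moreover have "f (X \<omega>) = G \<omega> * (w i \<omega> * w j \<omega>)" for \<omega>
      using ij by (simp add: f_def X_def G_def w_def dv_def sh_def share_def cong: restrict_cong)
    moreover have "g (Y \<omega>) = u i t \<omega> * u j t \<omega>" for \<omega>
      using ij t by (simp add: g_def Y_def)
    ultimately show ?thesis by simp
  qed
  have z2: "G \<omega> * (z \<omega>)\<^sup>2 = (\<Sum>i<N. \<Sum>j<N. G \<omega> * (w i \<omega> * w j \<omega>) * (u i t \<omega> * u j t \<omega>))" for \<omega>
  proof -
    have "(z \<omega>)\<^sup>2 = (\<Sum>i<N. \<Sum>j<N. (w i \<omega> * u i t \<omega>) * (w j \<omega> * u j t \<omega>))"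
      by (simp only: z_def granular_instrument_altdef w_def power2_eq_square sum_product)
    then show ?thesis by (simp add: sum_distrib_left mult_ac)
  qed
  \<comment> \<open>A product of independent integrable variables is integrable, so second moments
    of the shocks suffice here.\<close>
  have int: "integrable M (\<lambda>\<omega>. G \<omega> * (w i \<omega> * w j \<omega>) * (u i t \<omega> * u j t \<omega>))"
    if "i < N" "j < N" for i j
    using that by (intro indep_var_integrable ind Gww uu)
  have double_sum: "expectation (\<lambda>\<omega>. \<Sum>i<N. \<Sum>j<N. f i j \<omega>) = (\<Sum>i<N. \<Sum>j<N. expectation (f i j))"
    if "\<And>i j. i < N \<Longrightarrow> j < N \<Longrightarrow> integrable M (f i j)" for f :: "nat \<Rightarrow> nat \<Rightarrow> 'a \<Rightarrow> real"
    using that by (subst Bochner_Integration.integral_sum)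
      (auto intro!: Bochner_Integration.integrable_sum Bochner_Integration.integral_sum sum.cong)
  show "integrable M (\<lambda>\<omega>. G \<omega> * (z \<omega>)\<^sup>2)"
    unfolding z2 by (intro Bochner_Integration.integrable_sum int) auto
  have "expectation (\<lambda>\<omega>. G \<omega> * (z \<omega>)\<^sup>2)
      = (\<Sum>i<N. \<Sum>j<N. expectation (\<lambda>\<omega>. G \<omega> * (w i \<omega> * w j \<omega>) * (u i t \<omega> * u j t \<omega>)))"
    unfolding z2 by (rule double_sum[OF int])
  also have "\<dots> = (\<Sum>i<N. \<Sum>j<N. expectation (\<lambda>\<omega>. G \<omega> * (w i \<omega> * w j \<omega>)) * \<Omega> i j)"
    unfolding \<Omega>_def by (intro sum.cong refl indep_var_lebesgue_integral ind Gww uu) auto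
  \<comment> \<open>The sums return under the expectation, because the eigenvalue bound is applied
    to the realised weights at each \<open>\<omega>\<close>.\<close>
  also have "\<dots> = expectation (\<lambda>\<omega>. G \<omega> * (\<Sum>i<N. \<Sum>j<N. w i \<omega> * w j \<omega> * \<Omega> i j))"
  proof -
    have "expectation (\<lambda>\<omega>. \<Sum>i<N. \<Sum>j<N. G \<omega> * (w i \<omega> * w j \<omega>) * \<Omega> i j)
        = (\<Sum>i<N. \<Sum>j<N. expectation (\<lambda>\<omega>. G \<omega> * (w i \<omega> * w j \<omega>) * \<Omega> i j))"
      by (rule double_sum) (intro integrable_mult_left Gww)
    moreover have "(\<Sum>i<N. \<Sum>j<N. G \<omega> * (w i \<omega> * w j \<omega>) * \<Omega> i j)
        = G \<omega> * (\<Sum>i<N. \<Sum>j<N. w i \<omega> * w j \<omega> * \<Omega> i j)" for \<omega>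
      by (simp add: sum_distrib_left mult.assoc)
    ultimately show ?thesis by simp
  qed
  also have "\<dots> \<le> expectation (\<lambda>\<omega>. K * (G \<omega> * (\<Sum>i<N. (share N sz i \<omega>)\<^sup>2)))"
  proof (rule integral_mono)
    show "integrable M (\<lambda>\<omega>. G \<omega> * (\<Sum>i<N. \<Sum>j<N. w i \<omega> * w j \<omega> * \<Omega> i j))"
      unfolding sum_distrib_left mult.assoc[symmetric]
      by (intro Bochner_Integration.integrable_sum integrable_mult_left)
        (use Gww in \<open>simp add: mult.assoc\<close>)
    show "integrable M (\<lambda>\<omega>. K * (G \<omega> * (\<Sum>i<N. (share N sz i \<omega>)\<^sup>2)))"
      unfolding sum_distrib_left[of "G _"]
      by (intro Bochner_Integration.integrable_sum integrable_mult_right Gshsh) auto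
    fix \<omega>
    have mat: "second_moment_mat M N (\<lambda>i. u i t) = mat N N (\<lambda>(i, j). \<Omega> i j)"
      by (simp add: second_moment_mat_def \<Omega>_def)
    have "(\<Sum>i<N. \<Sum>j<N. w i \<omega> * w j \<omega> * \<Omega> i j) \<le> K * (\<Sum>i<N. (w i \<omega>)\<^sup>2)"
      by (rule quadratic_form_le_max_eigenvalue)
        (use eigenvalue_bounds[OF t] mat in \<open>auto simp: \<Omega>_def mult.commute\<close>)
    also have "\<dots> \<le> K * (\<Sum>i<N. (share N sz i \<omega>)\<^sup>2)"
      unfolding w_def using K_nonneg by (intro mult_left_mono sum_square_diff_mean_le)
    finally have "(\<Sum>i<N. \<Sum>j<N. w i \<omega> * w j \<omega> * \<Omega> i j) \<le> K * (\<Sum>i<N. (share N sz i \<omega>)\<^sup>2)" .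
    then show "G \<omega> * (\<Sum>i<N. \<Sum>j<N. w i \<omega> * w j \<omega> * \<Omega> i j) \<le> K * (G \<omega> * (\<Sum>i<N. (share N sz i \<omega>)\<^sup>2))"
      by (auto simp: G_def indicator_def)
  qed
  finally show "expectation (\<lambda>\<omega>. G \<omega> * (z \<omega>)\<^sup>2)
      \<le> K * expectation (\<lambda>\<omega>. G \<omega> * (\<Sum>i<N. (share N sz i \<omega>)\<^sup>2))"
    by simp
qed

end

section \<open>Truncated second moment of a Pareto variable\<close>

text \<open>Layer-cake formula: a squared value \<open>x\<^sup>2\<close> with
  \<open>x \<ge> 1\<close> is 1 plus the integral of \<open>2 * s\<close> from 1 to
  \<open>x\<close>. Exchanging the integrals leaves the integral of
  \<open>2 * s powr (1 - \<mu>)\<close> over \<open>{1..L}\<close>, which grows like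
  \<open>L powr (2 - \<mu>)\<close> for \<open>\<mu> < 2\<close> and stays bounded for
  \<open>\<mu> > 2\<close>; the exponent \<open>max 0 (2 - \<mu>)\<close> covers both. At
  \<open>\<mu> = 2\<close> the integral would be logarithmic.\<close>

lemma (in prob_space) truncated_pareto_second_moment:
  fixes X :: "'a \<Rightarrow> real"
  assumes [measurable]: "X \<in> borel_measurable M"
    and tail: "\<And>s. s \<ge> 1 \<Longrightarrow> prob {\<omega> \<in> space M. X \<omega> > s} = s powr (- \<mu>)"
    and \<mu>: "\<mu> \<noteq> 2" and L: "L \<ge> 1" and X1: "AE \<omega> in M. X \<omega> \<ge> 1"
  shows "expectation (\<lambda>\<omega>. (min (X \<omega>) L)\<^sup>2) \<le> (1 + 2 / \<bar>2 - \<mu>\<bar>) * L powr (max 0 (2 - \<mu>))"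
proof -
  interpret pair_sigma_finite M lborel ..
  define I where "I = 2 / (2 - \<mu>) * (L powr (2 - \<mu>) - 1)"
  define f where "f \<omega> s = ennreal (2 * s) * indicator {1..L} s * (if s < X \<omega> then 1 else 0)" for \<omega> s
  have [measurable]: "case_prod f \<in> borel_measurable (M \<Otimes>\<^sub>M lborel)"
    unfolding f_def by measurable
  have layers: "ennreal ((min (X \<omega>) L)\<^sup>2) \<le> 1 + (\<integral>\<^sup>+s. f \<omega> s \<partial>lborel)" if "X \<omega> \<ge> 1" for \<omega>
  proof -
    let ?m = "min (X \<omega>) L"
    have "(\<integral>\<^sup>+s. ennreal (2 * s) * indicator {1..?m} s \<partial>lborel) = ennreal (?m\<^sup>2 - 1\<^sup>2)"
      by (rule nn_integral_FTC_Icc) (use that L in \<open>auto intro!: derivative_eq_intros\<close>)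
    moreover have "(\<integral>\<^sup>+s. ennreal (2 * s) * indicator {1..?m} s \<partial>lborel) \<le> (\<integral>\<^sup>+s. f \<omega> s \<partial>lborel)"
    proof (rule nn_integral_mono_AE)
      \<comment> \<open>The strict inequality in \<open>f\<close> matches the tail assumption, while
        the interval on the left is closed. The two sides can conflict only at the endpoint
        \<open>?m\<close>, a null set.\<close>
      show "AE s in lborel. ennreal (2 * s) * indicator {1..?m} s \<le> f \<omega> s"
        using AE_lborel_singleton[of "?m"]
        by eventually_elim (auto simp: f_def indicator_def)
    qed
    ultimately have "1 + ennreal (?m\<^sup>2 - 1) \<le> 1 + (\<integral>\<^sup>+s. f \<omega> s \<partial>lborel)"
      by (intro add_left_mono) simp
    moreover have "1 + ennreal (?m\<^sup>2 - 1) = ennreal (?m\<^sup>2)"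
      using that L by (subst ennreal_1[symmetric], subst ennreal_plus[symmetric])
        (auto intro: one_le_power)
    ultimately show ?thesis by simp
  qed
  have inner: "(\<integral>\<^sup>+\<omega>. f \<omega> s \<partial>M) = ennreal (2 * s powr (1 - \<mu>)) * indicator {1..L} s" for s
  proof (cases "s \<in> {1..L}")
    case True
    have "(\<integral>\<^sup>+\<omega>. f \<omega> s \<partial>M)
        = (\<integral>\<^sup>+\<omega>. ennreal (2 * s) * indicator {\<omega> \<in> space M. X \<omega> > s} \<omega> \<partial>M)"
      using True by (intro nn_integral_cong) (auto simp: f_def indicator_def)
    also have "\<dots> = ennreal (2 * s) * emeasure M {\<omega> \<in> space M. X \<omega> > s}"
      by (rule nn_integral_cmult_indicator) measurable
    also have "\<dots> = ennreal (2 * s powr (1 - \<mu>))"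
      using True tail[of s]
      by (simp add: emeasure_eq_measure powr_diff powr_minus_divide flip: ennreal_mult)
    finally show ?thesis using True by simp
  qed (simp add: f_def)
  have "expectation (\<lambda>\<omega>. (min (X \<omega>) L)\<^sup>2) \<le> 1 + I"
  proof -
    have bounded: "AE \<omega> in M. norm ((min (X \<omega>) L)\<^sup>2) \<le> L\<^sup>2"
      using X1 by eventually_elim (use L in \<open>auto intro!: power_mono\<close>)
    have "ennreal (expectation (\<lambda>\<omega>. (min (X \<omega>) L)\<^sup>2)) = (\<integral>\<^sup>+\<omega>. ennreal ((min (X \<omega>) L)\<^sup>2) \<partial>M)"
      by (intro nn_integral_eq_integral[symmetric] integrable_const_bound[OF bounded]) auto
    also have "\<dots> \<le> (\<integral>\<^sup>+\<omega>. 1 + (\<integral>\<^sup>+s. f \<omega> s \<partial>lborel) \<partial>M)"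
    proof (rule nn_integral_mono_AE)
      show "AE \<omega> in M. ennreal ((min (X \<omega>) L)\<^sup>2) \<le> 1 + (\<integral>\<^sup>+s. f \<omega> s \<partial>lborel)"
        using X1 by eventually_elim (rule layers)
    qed
    also have "\<dots> = 1 + (\<integral>\<^sup>+\<omega>. (\<integral>\<^sup>+s. f \<omega> s \<partial>lborel) \<partial>M)"
      by (subst nn_integral_add) (auto simp: emeasure_space_1)
    also have "(\<integral>\<^sup>+\<omega>. (\<integral>\<^sup>+s. f \<omega> s \<partial>lborel) \<partial>M) = (\<integral>\<^sup>+s. (\<integral>\<^sup>+\<omega>. f \<omega> s \<partial>M) \<partial>lborel)"
      by (rule Fubini'[symmetric]) measurable
    also have "\<dots> = ennreal (2 / (2 - \<mu>) * L powr (2 - \<mu>) - 2 / (2 - \<mu>) * 1 powr (2 - \<mu>))"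
      unfolding inner
    proof (rule nn_integral_FTC_Icc)
      fix x assume "x \<in> {1..L}"
      then show "((\<lambda>x. 2 / (2 - \<mu>) * x powr (2 - \<mu>)) has_real_derivative 2 * x powr (1 - \<mu>)) (at x)"
        using \<mu> by (auto intro!: derivative_eq_intros)
    qed (use L in auto)
    also have "2 / (2 - \<mu>) * L powr (2 - \<mu>) - 2 / (2 - \<mu>) * 1 powr (2 - \<mu>) = I"
      by (simp add: I_def right_diff_distrib)
    finally have "ennreal (expectation (\<lambda>\<omega>. (min (X \<omega>) L)\<^sup>2)) \<le> 1 + ennreal I" .
    \<comment> \<open>Nonnegativity allows the bound in \<open>ennreal\<close> to be read as one
      between reals. For \<open>\<mu> > 2\<close> both factors of \<open>I\<close> are
      nonpositive.\<close>
    moreover have "I \<ge> 0"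
    proof (cases "\<mu> < 2")
      case True
      then show ?thesis using L by (simp add: I_def ge_one_powr_ge_zero)
    next
      case False
      then have "L powr (2 - \<mu>) \<le> 1" using L powr_mono[of "2 - \<mu>" 0 L] by simp
      then show ?thesis using False by (auto simp: I_def zero_le_mult_iff zero_le_divide_iff)
    qed
    ultimately show ?thesis
      by (simp flip: ennreal_1 ennreal_plus)
  qed
  also have "1 + I \<le> (1 + 2 / \<bar>2 - \<mu>\<bar>) * L powr (max 0 (2 - \<mu>))"
  proof (cases "\<mu> < 2")
    case True
    then have "L powr (2 - \<mu>) \<ge> 1" using L by (simp add: ge_one_powr_ge_zero)
    moreover have "2 / (2 - \<mu>) \<ge> 0" using True by simp
    ultimately show ?thesis using True
      by (simp add: I_def algebra_simps diff_divide_distrib add_increasing2)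
  next
    case False
    then have "I = 2 / \<bar>2 - \<mu>\<bar> * (1 - L powr (2 - \<mu>))"
      by (simp add: I_def algebra_simps minus_divide_right[symmetric] divide_simps)
    also have "\<dots> \<le> 2 / \<bar>2 - \<mu>\<bar> * 1" by (intro mult_left_mono) auto
    finally show ?thesis using False L by simp
  qed
  finally show ?thesis .
qed

section \<open>A criterion for boundedness in probability\<close>

text \<open>The truncation parameter \<open>b\<close> is chosen first, making the discarded mass
  small; then \<open>c\<close> is chosen, depending on \<open>b\<close>, to make the Markov term
  small. Neither choice depends on \<open>n\<close>.\<close>

lemma bigO_in_probI:
  assumes \<mu>: "\<mu> > 0" and C: "C \<ge> 0"
    and bound: "\<And>n b c. n \<ge> 1 \<Longrightarrow> b \<ge> 1 \<Longrightarrow> c > 0 \<Longrightarrow>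
      measure M {\<omega> \<in> space M. \<bar>X n \<omega>\<bar> > c * \<bar>a n\<bar>} \<le> b powr (- \<mu>) + C * b powr \<gamma> / c\<^sup>2"
  shows "bigO_in_prob M X a"
  unfolding bigO_in_prob_def
proof (intro allI impI)
  fix \<delta> :: real assume \<delta>: "\<delta> > 0"
  have "((\<lambda>b::real. b powr (- \<mu>)) \<longlongrightarrow> 0) at_top"
    using \<mu> by (intro tendsto_neg_powr filterlim_ident) auto
  then have "\<forall>\<^sub>F b in at_top. b powr (- \<mu>) < \<delta> / 2 \<and> b \<ge> 1"
    using \<delta> by (intro eventually_conj order_tendstoD eventually_ge_at_top) auto
  then obtain b where b: "b powr (- \<mu>) < \<delta> / 2" "b \<ge> 1"
    by (auto simp: eventually_at_top_linorder)
  define e where "e = C * b powr \<gamma>"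
  \<comment> \<open>With this value \<open>e / c\<^sup>2\<close> equals \<open>\<delta> / 2\<close>
    times \<open>e / (e + 1)\<close>. The \<open>+ 1\<close> gives strict inequality and keeps
    \<open>c\<close> positive when \<open>e = 0\<close>.\<close>
  define c where "c = sqrt (2 * (e + 1) / \<delta>)"
  have e: "e \<ge> 0" using C by (simp add: e_def)
  have c: "c > 0" "c\<^sup>2 = 2 * (e + 1) / \<delta>" using e \<delta> by (auto simp: c_def)
  have "e / c\<^sup>2 < \<delta> / 2" using e \<delta> by (simp add: c(2) field_simps)
  then have "measure M {\<omega> \<in> space M. \<bar>X n \<omega>\<bar> > c * \<bar>a n\<bar>} < \<delta>" if "n \<ge> 1" for n
    using bound[OF that b(2) c(1)] b(1) unfolding e_def by linarith
  then show "\<exists>B>0. \<forall>\<^sub>F n in sequentially. measure M {\<omega> \<in> space M. \<bar>X n \<omega>\<bar> > B * \<bar>a n\<bar>} < \<delta>"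
    using c(1) by (intro exI[of _ c] conjI eventually_sequentiallyI[of 1])
qed

section \<open>Tail bounds for the instrument at a fixed number of units\<close>

context regular_granular_market
begin

text \<open>The Pareto tail at \<open>s = 1\<close> already has probability 1.\<close>

lemma size_ge_1: "AE \<omega> in M. \<forall>i<N. sz i \<omega> \<ge> 1"
proof -
  have "AE \<omega> in M. \<forall>i\<in>{..<N}. sz i \<omega> \<ge> 1"
  proof (rule AE_finite_allI)
    fix i assume "i \<in> {..<N}"
    then have "AE \<omega> in M. \<omega> \<in> {\<omega> \<in> space M. sz i \<omega> > 1}"
      using pareto[of i 1] by (intro AE_prob_1) simp
    then show "AE \<omega> in M. sz i \<omega> \<ge> 1" by eventually_elim simp
  qed simp
  then show ?thesis by eventually_elim simp
qed

lemma sum_share: "AE \<omega> in M. (\<Sum>i<N. share N sz i \<omega>) = 1"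
  using size_ge_1
proof eventually_elim
  case (elim \<omega>)
  then have "(\<Sum>j<N. sz j \<omega>) > 0" using N_pos by (intro sum_pos) (force simp: lessThan_empty_iff)+
  then show ?case by (simp add: share_def flip: sum_divide_distrib)
qed

text \<open>Markov's inequality for the squared instrument restricted to the event \<open>C\<close>;
  the complement is charged at its full probability. The two bounds below differ only in the choice
  of \<open>C\<close>.\<close>

lemma prob_instrument_gt_le:
  assumes t: "t \<in> T" and K: "0 \<le> K" and c: "c > 0"
    and [measurable]: "C \<in> sets (\<Pi>\<^sub>M i\<in>{..<N}. borel)"
  defines "X \<equiv> \<lambda>\<omega>. \<lambda>i\<in>{..<N}. sz i \<omega>"
  shows "prob {\<omega> \<in> space M. \<bar>granular_instrument N sz (\<lambda>i. u i t) \<omega>\<bar> > c}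
    \<le> prob {\<omega> \<in> space M. X \<omega> \<notin> C}
      + K * expectation (\<lambda>\<omega>. indicator C (X \<omega>) * (\<Sum>i<N. (share N sz i \<omega>)\<^sup>2)) / c\<^sup>2"
proof -
  let ?z = "granular_instrument N sz (\<lambda>i. u i t)"
  let ?q = "\<lambda>\<omega>. indicator C (X \<omega>) * (?z \<omega>)\<^sup>2"
  note [measurable] = sz_measurable
  have [measurable]: "X \<in> measurable M (\<Pi>\<^sub>M i\<in>{..<N}. borel)" unfolding X_def by measurable
  have int: "integrable M ?q" unfolding X_def by (rule second_moment_le(1)[OF t K assms(4)])
  then have [measurable]: "?q \<in> borel_measurable M" by simp
  have "prob {\<omega> \<in> space M. \<bar>?z \<omega>\<bar> > c} \<le> prob ({\<omega> \<in> space M. X \<omega> \<notin> C} \<union> {\<omega> \<in> space M. ?q \<omega> \<ge> c\<^sup>2})"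
  proof (rule finite_measure_mono)
    show "{\<omega> \<in> space M. \<bar>?z \<omega>\<bar> > c} \<subseteq> {\<omega> \<in> space M. X \<omega> \<notin> C} \<union> {\<omega> \<in> space M. ?q \<omega> \<ge> c\<^sup>2}"
      using c by (auto simp: indicator_def abs_le_square_iff[symmetric])
  qed measurable
  also have "\<dots> \<le> prob {\<omega> \<in> space M. X \<omega> \<notin> C} + prob {\<omega> \<in> space M. ?q \<omega> \<ge> c\<^sup>2}"
    by (rule measure_Un_le) measurable
  also have "prob {\<omega> \<in> space M. ?q \<omega> \<ge> c\<^sup>2} \<le> expectation ?q / c\<^sup>2"
    using c by (intro integral_Markov_inequality_measure[where A = "space M"] int) auto
  also have "\<dots> \<le> K * expectation (\<lambda>\<omega>. indicator C (X \<omega>) * (\<Sum>i<N. (share N sz i \<omega>)\<^sup>2)) / c\<^sup>2"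
    unfolding X_def by (intro divide_right_mono second_moment_le(2)[OF t K assms(4)]) simp
  finally show ?thesis by simp
qed

text \<open>Here \<open>C\<close> is the whole space, so nothing is discarded. Shares in the unit
  interval that sum to 1 have squares summing to at most 1.\<close>

lemma prob_instrument_gt_le_const:
  assumes t: "t \<in> T" and K: "0 \<le> K" and c: "c > 0"
  shows "prob {\<omega> \<in> space M. \<bar>granular_instrument N sz (\<lambda>i. u i t) \<omega>\<bar> > c} \<le> K / c\<^sup>2"
proof -
  let ?X = "\<lambda>\<omega>. \<lambda>i\<in>{..<N}. sz i \<omega>" and ?C = "space (\<Pi>\<^sub>M i\<in>{..<N}. borel :: real measure)"
  have "expectation (\<lambda>\<omega>. indicator ?C (?X \<omega>) * (\<Sum>i<N. (share N sz i \<omega>)\<^sup>2)) \<le> expectation (\<lambda>\<omega>. 1)"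
  proof (rule integral_mono_AE')
    show "AE \<omega> in M. indicator ?C (?X \<omega>) * (\<Sum>i<N. (share N sz i \<omega>)\<^sup>2) \<le> 1"
      using share_bounds sum_share
    proof eventually_elim
      case (elim \<omega>)
      have "(\<Sum>i<N. (share N sz i \<omega>)\<^sup>2) \<le> (\<Sum>i<N. share N sz i \<omega>)"
        using elim by (intro sum_mono) (simp add: power2_eq_square mult_left_le)
      then show ?case using elim by (auto simp: indicator_def)
    qed
  qed auto
  then have "K * expectation (\<lambda>\<omega>. indicator ?C (?X \<omega>) * (\<Sum>i<N. (share N sz i \<omega>)\<^sup>2)) / c\<^sup>2 \<le> K / c\<^sup>2"
    using K by (intro divide_right_mono) (auto simp: mult_left_le prob_space)
  moreover have "prob {\<omega> \<in> space M. ?X \<omega> \<notin> ?C} = 0" by (simp add: space_PiM)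
  ultimately show ?thesis
    using prob_instrument_gt_le[OF t K c sets.top] by linarith
qed

text \<open>Here \<open>C\<close> is the box on which no size exceeds \<open>L\<close>. A union
  bound over the units controls its complement. Inside it, the index is at most a sum of
  \<open>N\<close> truncated squares divided by the square of \<open>N\<close>, which leaves one
  factor \<open>1 / N\<close>.\<close>

lemma prob_instrument_gt_le_truncated:
  fixes c :: real
  assumes t: "t \<in> T" and K: "0 \<le> K" and c: "c > 0" and L: "L \<ge> 1" and \<mu>: "\<mu> \<noteq> 2"
  shows "prob {\<omega> \<in> space M. \<bar>granular_instrument N sz (\<lambda>i. u i t) \<omega>\<bar> > c}
    \<le> N * L powr (- \<mu>) + K * (1 + 2 / \<bar>2 - \<mu>\<bar>) * L powr (max 0 (2 - \<mu>)) / (N * c\<^sup>2)"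
proof -
  let ?X = "\<lambda>\<omega>. \<lambda>i\<in>{..<N}. sz i \<omega>" and ?C = "PiE {..<N} (\<lambda>i. {..L})"
  let ?E = "expectation (\<lambda>\<omega>. indicator ?C (?X \<omega>) * (\<Sum>i<N. (share N sz i \<omega>)\<^sup>2))"
  let ?D = "(1 + 2 / \<bar>2 - \<mu>\<bar>) * L powr (max 0 (2 - \<mu>))"
  note [measurable] = sz_measurable
  have "prob {\<omega> \<in> space M. ?X \<omega> \<notin> ?C} \<le> prob (\<Union>i\<in>{..<N}. {\<omega> \<in> space M. sz i \<omega> > L})"
    by (intro finite_measure_mono sets.finite_UN) (auto simp: PiE_iff not_le)
  also have "\<dots> \<le> (\<Sum>i<N. prob {\<omega> \<in> space M. sz i \<omega> > L})"
    by (rule measure_UNION_le) auto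
  also have "\<dots> = N * L powr (- \<mu>)" using pareto L by simp
  finally have large: "prob {\<omega> \<in> space M. ?X \<omega> \<notin> ?C} \<le> N * L powr (- \<mu>)" .
  have int: "integrable M (\<lambda>\<omega>. (min (sz i \<omega>) L)\<^sup>2)" if "i < N" for i
  proof (rule integrable_const_bound)
    show "AE \<omega> in M. norm ((min (sz i \<omega>) L)\<^sup>2) \<le> L\<^sup>2"
      using size_ge_1 by eventually_elim (use L that in \<open>auto intro!: power_mono simp: min_def\<close>)
  qed (use that in measurable)
  have "?E \<le> expectation (\<lambda>\<omega>. (\<Sum>i<N. (min (sz i \<omega>) L)\<^sup>2) / (real N)\<^sup>2)"
  proof (rule integral_mono_AE')
    show "integrable M (\<lambda>\<omega>. (\<Sum>i<N. (min (sz i \<omega>) L)\<^sup>2) / (real N)\<^sup>2)"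
      by (intro integrable_divide Bochner_Integration.integrable_sum int) simp
    show "AE \<omega> in M. indicator ?C (?X \<omega>) * (\<Sum>i<N. (share N sz i \<omega>)\<^sup>2)
        \<le> (\<Sum>i<N. (min (sz i \<omega>) L)\<^sup>2) / (real N)\<^sup>2"
      using size_ge_1
    proof eventually_elim
      case (elim \<omega>)
      have "real N = (\<Sum>i<N. 1)" by simp
      also have "\<dots> \<le> (\<Sum>i<N. sz i \<omega>)" using elim by (intro sum_mono) simp
      finally have total: "real N \<le> (\<Sum>i<N. sz i \<omega>)" .
      have "(share N sz i \<omega>)\<^sup>2 \<le> (sz i \<omega>)\<^sup>2 / (real N)\<^sup>2" if "i < N" for i
      proof -
        have "sz i \<omega> \<ge> 1" using elim that by blast
        then have "share N sz i \<omega> \<le> sz i \<omega> / N" "0 \<le> share N sz i \<omega>"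
          unfolding share_def using total N_pos
          by (auto intro!: divide_left_mono divide_nonneg_nonneg)
        then show ?thesis by (simp add: power_mono flip: power_divide)
      qed
      then have *: "(\<Sum>i<N. (share N sz i \<omega>)\<^sup>2) \<le> (\<Sum>i<N. (sz i \<omega>)\<^sup>2) / (real N)\<^sup>2"
        unfolding sum_divide_distrib by (intro sum_mono) simp
      \<comment> \<open>On the box the truncation is inactive; off the box the left side vanishes
        and the right side is nonnegative.\<close>
      show ?case
      proof (cases "?X \<omega> \<in> ?C")
        case True
        then have "min (sz i \<omega>) L = sz i \<omega>" if "i < N" for i
          using that by (auto simp: PiE_iff min_def)
        then show ?thesis using True * by simp
      qed (auto intro!: divide_nonneg_nonneg sum_nonneg)
    qed
  qed (auto intro!: divide_nonneg_nonneg sum_nonneg)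
  also have "\<dots> = (\<Sum>i<N. expectation (\<lambda>\<omega>. (min (sz i \<omega>) L)\<^sup>2)) / (real N)\<^sup>2"
    using int by simp
  also have "\<dots> \<le> (\<Sum>i<N. ?D) / (real N)\<^sup>2"
  proof (intro divide_right_mono sum_mono)
    fix i assume i: "i \<in> {..<N}"
    have "AE \<omega> in M. sz i \<omega> \<ge> 1" using size_ge_1 by eventually_elim (use i in simp)
    with i show "expectation (\<lambda>\<omega>. (min (sz i \<omega>) L)\<^sup>2) \<le> ?D"
      by (intro truncated_pareto_second_moment pareto \<mu> L sz_measurable) auto
  qed simp
  also have "\<dots> = ?D / N" using N_pos by (simp add: power2_eq_square)
  finally have "K * ?E / c\<^sup>2 \<le> K * (?D / N) / c\<^sup>2"
    using K by (intro divide_right_mono mult_left_mono) auto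
  also have "\<dots> = K * (1 + 2 / \<bar>2 - \<mu>\<bar>) * L powr (max 0 (2 - \<mu>)) / (N * c\<^sup>2)"
    by (simp add: mult_ac)
  finally have small: "K * ?E / c\<^sup>2 \<le> K * (1 + 2 / \<bar>2 - \<mu>\<bar>) * L powr (max 0 (2 - \<mu>)) / (N * c\<^sup>2)" .
  have C: "?C \<in> sets (\<Pi>\<^sub>M i\<in>{..<N}. borel)" by (intro sets_PiM_I_finite) auto
  from prob_instrument_gt_le[OF t K c C] large small show ?thesis by linarith
qed

end

section \<open>Rates for the three ranges of the tail index\<close>

theorem proposition1:
  fixes M :: "'a measure"
    and r :: nat
    and \<phi>\<^sub>d \<phi>\<^sub>s \<mu> \<kappa> K :: real
    and T :: "int set"
    and sz :: "nat \<Rightarrow> nat \<Rightarrow> 'a \<Rightarrow> real"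
    and lam :: "nat \<Rightarrow> nat \<Rightarrow> nat \<Rightarrow> 'a \<Rightarrow> real"
    and F u y :: "nat \<Rightarrow> nat \<Rightarrow> int \<Rightarrow> 'a \<Rightarrow> real"
    and \<epsilon> p d :: "nat \<Rightarrow> int \<Rightarrow> 'a \<Rightarrow> real"
  assumes "0 < \<mu>" "\<mu> \<noteq> 1" "\<mu> \<noteq> 2"
    and "0 < \<kappa>" "\<kappa> \<le> K"
    and "\<And>N. N \<ge> 1 \<Longrightarrow>
      regular_granular_market M N r \<phi>\<^sub>d \<phi>\<^sub>s T (sz N) (lam N) (F N) (u N) (\<epsilon> N) (p N) (d N) (y N)
        \<mu> \<kappa> K"
    and "t \<in> T"
  shows "let z = (\<lambda>N. granular_instrument N (sz N) (\<lambda>i. u N i t)) in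
         (\<mu> < 1 \<longrightarrow> bigO_in_prob M z (\<lambda>N. 1)) \<and>
         (1 < \<mu> \<and> \<mu> < 2 \<longrightarrow> bigO_in_prob M z (\<lambda>N. real N powr (- (1 - 1 / \<mu>)))) \<and>
         (2 < \<mu> \<longrightarrow> bigO_in_prob M z (\<lambda>N. real N powr (- (1 / 2))))"
proof -
  define z where "z = (\<lambda>N. granular_instrument N (sz N) (\<lambda>i. u N i t))"
  have K: "0 \<le> K" using assms(4,5) by simp
  \<comment> \<open>This bound holds for every \<open>\<mu> > 0\<close> and serves the case
    \<open>\<mu> < 1\<close>. Without truncation \<open>b\<close> has no role, so
    \<open>\<gamma> = 0\<close> and the term \<open>b powr (- \<mu>)\<close> is mere slack.\<close>
  have "bigO_in_prob M z (\<lambda>N. 1)"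
  proof (rule bigO_in_probI[OF \<open>0 < \<mu>\<close> K, where \<gamma> = 0])
    fix N :: nat and b c :: real assume N: "N \<ge> 1" and b: "b \<ge> 1" and c: "c > 0"
    interpret regular_granular_market M N r \<phi>\<^sub>d \<phi>\<^sub>s T "sz N" "lam N" "F N" "u N" "\<epsilon> N" "p N" "d N"
      "y N" \<mu> \<kappa> K
      by (rule assms(6)[OF N])
    show "prob {\<omega> \<in> space M. \<bar>z N \<omega>\<bar> > c * \<bar>1\<bar>} \<le> b powr (- \<mu>) + K * b powr 0 / c\<^sup>2"
      using prob_instrument_gt_le_const[OF assms(7) K c] b
      by (simp add: z_def add_increasing)
  qed
  \<comment> \<open>One computation serves both remaining cases. The condition on
    \<open>\<rho>\<close> is the one under which the powers of \<open>N\<close> cancel in the Markov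
    term; it gives \<open>1 - 1 / \<mu>\<close> below 2 and \<open>1 / 2\<close> above.\<close>
  moreover have "bigO_in_prob M z (\<lambda>N. real N powr (- \<rho>))"
    if \<rho>: "2 * \<rho> = 1 - max 0 (2 - \<mu>) / \<mu>" for \<rho>
  proof (rule bigO_in_probI[OF \<open>0 < \<mu>\<close>, where C = "K * (1 + 2 / \<bar>2 - \<mu>\<bar>)" and \<gamma> = "max 0 (2 - \<mu>)"])
    show "0 \<le> K * (1 + 2 / \<bar>2 - \<mu>\<bar>)" using K by simp
    fix N :: nat and b c :: real assume N: "N \<ge> 1" and b: "b \<ge> 1" and c: "c > 0"
    interpret regular_granular_market M N r \<phi>\<^sub>d \<phi>\<^sub>s T "sz N" "lam N" "F N" "u N" "\<epsilon> N" "p N" "d N"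
      "y N" \<mu> \<kappa> K
      by (rule assms(6)[OF N])
    \<comment> \<open>The power \<open>N powr (1 / \<mu>)\<close> is the order of magnitude of the
      largest of \<open>N\<close> Pareto sizes, so the union bound becomes
      \<open>b powr (- \<mu>)\<close> for every \<open>N\<close>.\<close>
    define L where "L = b * real N powr (1 / \<mu>)"
    define \<gamma> where "\<gamma> = max 0 (2 - \<mu>)"
    let ?a = "real N powr (- \<rho>)"
    have "real N powr (1 / \<mu>) \<ge> 1" using N \<open>0 < \<mu>\<close> by (simp add: ge_one_powr_ge_zero)
    then have L: "L \<ge> 1" using b mult_mono[of 1 b 1 "real N powr (1 / \<mu>)"] by (simp add: L_def)
    have ca: "c * ?a > 0" using c N by simp
    have "N * L powr (- \<mu>) = b powr (- \<mu>)"
      using N b \<open>0 < \<mu>\<close> by (simp add: L_def powr_mult powr_powr powr_minus)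
    moreover have "L powr \<gamma> / (N * (c * ?a)\<^sup>2) = b powr \<gamma> / c\<^sup>2"
    proof -
      have "N * ?a\<^sup>2 = real N powr (1 - 2 * \<rho>)"
        using N by (simp add: powr_diff powr_minus powr_powr divide_inverse power_inverse mult.commute[of \<rho>]
            flip: powr_numeral[of "real N powr \<rho>"] powr_realpow)
      also have "1 - 2 * \<rho> = 1 / \<mu> * \<gamma>" using \<rho> by (simp add: \<gamma>_def)
      finally have "L powr \<gamma> = b powr \<gamma> * (N * ?a\<^sup>2)"
        using b by (simp add: L_def powr_mult powr_powr)
      then show ?thesis using N by (simp add: power_mult_distrib)
    qed
    ultimately show "prob {\<omega> \<in> space M. \<bar>z N \<omega>\<bar> > c * \<bar>?a\<bar>}
        \<le> b powr (- \<mu>) + K * (1 + 2 / \<bar>2 - \<mu>\<bar>) * b powr (max 0 (2 - \<mu>)) / c\<^sup>2"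
      using prob_instrument_gt_le_truncated[OF assms(7) K ca L \<open>\<mu> \<noteq> 2\<close>]
      by (simp add: z_def \<gamma>_def[symmetric] flip: times_divide_eq_right)
  qed
  moreover have "2 * (1 - 1 / \<mu>) = 1 - max 0 (2 - \<mu>) / \<mu>" if "\<mu> < 2"
    using that \<open>0 < \<mu>\<close> by (simp add: field_simps)
  moreover have "2 * (1 / 2) = 1 - max 0 (2 - \<mu>) / \<mu>" if "2 < \<mu>"
    using that by simp
  ultimately show ?thesis
    unfolding Let_def z_def[symmetric] by blast
qed

end
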